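(* For all positive integers $m,n$, \[ \frac{P^+_{m,n}}{m}\le \sum_{k=1}^{n}\frac1{k!}<e-1 . \] Equality holds in the first inequality when $m=1$ or $n=1$. The universal constant $e-1$ cannot be reduced: namely, \[ \sup_{m,n\ge1}\frac{P^+_{m,n}}{m}=e-1 . \]
   Context: Card guessing with yes/no (partial) feedback. Fix positive integers $m,n$; let $[n]=\{1,\dots,n\}$ and let $\Omega_{m,n}$ be the set of words of length $mn$ over $[n]$ in which each label occurs exactly $m$ times. The card sequence $X=(X_1,\dots,X_{mn})$ is uniform on $\Omega_{m,n}$. In round $t=1,\dots,mn$ the player first guesses $G_t\in[n]$ and then receives only the feedback $Y_t=\mathbf 1\{G_t=X_t\}$. A strategy $A$ is a rule in which each guess $G_t$ may depend on all previous guesses and feedback and on a random seed independent of the card sequence (no restrictions on memory or computation). A deterministic strategy is a family of functions $A_t:\{0,1\}^{t-1}\to[n]$, with $G_t=A_t(Y_1,\dots,Y_{t-1})$. The score is $S=\sum_{t=1}^{mn}Y_t$, and $P^+_{m,n}=\sup_A\mathbb E_A S$, where the supremum is over all strategies $A$ and $\mathbb E_A S$ is the expected score under $A$. *)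

theory Defs
  imports "HOL-Probability.Probability"
begin

definition deck_words :: "nat \<Rightarrow> nat \<Rightarrow> nat list set" where
  "deck_words m n =
     {w. length w = m * n \<and> set w \<subseteq> {1..n} \<and> (\<forall>k\<in>{1..n}. count_list w k = m)}"

text \<open>A player maps the seed and the history, a list of pairs (guess, feedback) in chronological
  order, to the next guess.  Rounds are numbered from 0, so round \<open>t\<close> concerns the card \<open>w ! t\<close>.\<close>

type_synonym history = "(nat \<times> bool) list"

type_synonym 's player = "'s \<Rightarrow> history \<Rightarrow> nat"

primrec play :: "'s player \<Rightarrow> 's \<Rightarrow> nat list \<Rightarrow> nat \<Rightarrow> history" where
  "play A s w 0 = []"
| "play A s w (Suc t) =
     (let h = play A s w t; g = A s h in h @ [(g, g = w ! t)])"

definition guess :: "'s player \<Rightarrow> 's \<Rightarrow> nat list \<Rightarrow> nat \<Rightarrow> nat" where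
  "guess A s w t = A s (play A s w t)"

definition score :: "'s player \<Rightarrow> 's \<Rightarrow> nat list \<Rightarrow> real" where
  "score A s w = (\<Sum>t<length w. of_bool (guess A s w t = w ! t))"

text \<open>The seed is a random element with law \<open>M\<close>.  Measurability into \<open>count_space {1..n}\<close> also
  says that every guess is a label in \<open>{1..n}\<close>.\<close>

definition strategy :: "nat \<Rightarrow> 's measure \<Rightarrow> 's player \<Rightarrow> bool" where
  "strategy n M A \<longleftrightarrow>
     prob_space M \<and> (\<forall>h. (\<lambda>s. A s h) \<in> measurable M (count_space {1..n}))"

text \<open>The product measure makes the seed independent of the uniformly distributed card sequence.\<close>

definition expected_score :: "nat \<Rightarrow> nat \<Rightarrow> 's measure \<Rightarrow> 's player \<Rightarrow> real" where
  "expected_score m n M A =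
     (\<integral>(s, w). score A s w \<partial>(M \<Otimes>\<^sub>M measure_pmf (pmf_of_set (deck_words m n))))"

text \<open>The supremum ranges over all probability spaces on the seed type \<open>'s\<close>.  As a definition
  cannot quantify over types, the seed type is a parameter; results are to be stated for
  arbitrary \<open>'s\<close>.  The set is nonempty for \<open>n \<ge> 1\<close> and bounded above by \<open>m * n\<close>, so that
  the real-valued supremum is the genuine one.\<close>

definition Pplus :: "'s itself \<Rightarrow> nat \<Rightarrow> nat \<Rightarrow> real" where
  "Pplus _ m n =
     Sup {expected_score m n M A | (M :: 's measure) (A :: 's player). strategy n M A}"

end

theory Submission
  imports Defs "HOL-Combinatorics.Permutations"
begin

text \<open>The upper bound for general \<open>m\<close> comes from the case of a single permutation, by giving the player
  extra information. Choose one copy of each label uniformly at random, that is, a random transversal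
  \<open>T\<close> of the deck, and reveal all cards off \<open>T\<close>. Then the cards on \<open>T\<close> form a uniformly random
  permutation, and rounds off \<open>T\<close> teach the player nothing about it. As each position lies in \<open>T\<close> with
  probability \<open>1 / m\<close>, the expected score is \<open>m\<close> times the expected number of hits on \<open>T\<close>
  (\<open>sum_card_Int_transversals\<close>).

  For a permutation of \<open>n\<close> labels, the probability of at least \<open>k\<close> hits is at most \<open>1 / fact k\<close>: the
  positions of the first \<open>k\<close> hits determine the whole feedback up to the last of them, hence the guesses,
  hence the \<open>k\<close> cards that were hit (\<open>first_hits_determine_cards\<close>). So at most
  \<open>(n choose k) * fact (n - k) = fact n / fact k\<close> permutations give \<open>k\<close> hits or more
  (\<open>card_refillings_many_hits\<close>), and summing over \<open>k\<close> bounds the mean.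

  For \<open>m = 1\<close> the bound is attained by guessing 1 until it is hit, then 2, and so on: this scores at
  least \<open>k\<close> whenever the labels \<open>1, \<dots>, k\<close> appear in increasing order, which has probability
  \<open>1 / fact k\<close> (\<open>score_ge_if_ordered\<close>, \<open>card_deck_words_le_ordered\<close>). The sums of inverse factorials
  stay below \<open>exp 1 - 1\<close> and converge to it, so \<open>m = 1\<close> already gives the supremum.\<close>

section \<open>Refilling a word on a set of positions\<close>

definition hits :: "'s player \<Rightarrow> 's \<Rightarrow> nat list \<Rightarrow> nat set" where
  "hits A s w = {t. t < length w \<and> guess A s w t = w ! t}"

lemma finite_hits [simp]: "finite (hits A s w)"
  by (simp add: hits_def)

lemma score_eq_card_hits: "score A s w = card (hits A s w)"
proof -
  have "{..<length w} \<inter> {t. guess A s w t = w ! t} = hits A s w"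
    by (auto simp: hits_def)
  thus ?thesis by (simp add: score_def)
qed

text \<open>For \<open>v\<close> injective on \<open>D\<close>, these are the rearrangements of \<open>v\<close> that move cards only within \<open>D\<close>:
  the decks that remain possible for somebody who knows all cards outside \<open>D\<close> and the set of cards
  on \<open>D\<close>.\<close>

definition refillings :: "'a list \<Rightarrow> nat set \<Rightarrow> 'a list set" where
  "refillings v D = {w. length w = length v \<and> (\<forall>i<length v. i \<notin> D \<longrightarrow> w ! i = v ! i) \<and>
     bij_betw ((!) w) D ((!) v ` D)}"

lemma refillings_eq_permutes:
  assumes "inj_on ((!) v) D" "D \<subseteq> {..<length v}"
  shows "bij_betw (\<lambda>p. map (\<lambda>i. v ! p i) [0..<length v]) {p. p permutes D} (refillings v D)"
proof (rule bij_betwI')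
  fix p q assume "p \<in> {p. p permutes D}" "q \<in> {p. p permutes D}"
  hence p: "p permutes D" and q: "q permutes D" by auto
  show "map (\<lambda>i. v ! p i) [0..<length v] = map (\<lambda>i. v ! q i) [0..<length v] \<longleftrightarrow> p = q"
  proof
    assume eq: "map (\<lambda>i. v ! p i) [0..<length v] = map (\<lambda>i. v ! q i) [0..<length v]"
    show "p = q"
    proof
      fix i
      show "p i = q i"
      proof (cases "i \<in> D")
        case True
        hence "v ! p i = v ! q i" using eq assms(2) by auto
        moreover have "p i \<in> D" "q i \<in> D"
          using True permutes_in_image[OF p] permutes_in_image[OF q] by auto
        ultimately show ?thesis using assms(1) by (auto dest: inj_onD)
      next
        case False thus ?thesis using p q by (simp add: permutes_def)
      qed
    qed
  qed auto
next
  fix p assume "p \<in> {p. p permutes D}"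
  hence p: "p permutes D" by auto
  let ?w = "map (\<lambda>i. v ! p i) [0..<length v]"
  have "bij_betw (\<lambda>i. v ! p i) D ((!) v ` D)"
    using bij_betw_trans[OF permutes_imp_bij[OF p] inj_on_imp_bij_betw[OF assms(1)]]
    by (simp add: o_def)
  moreover have "bij_betw ((!) ?w) D ((!) v ` D) \<longleftrightarrow> bij_betw (\<lambda>i. v ! p i) D ((!) v ` D)"
    using assms(2) by (intro bij_betw_cong) auto
  ultimately show "?w \<in> refillings v D"
    using p by (auto simp: refillings_def permutes_def)
next
  fix w assume w: "w \<in> refillings v D"
  hence len: "length w = length v" and off: "\<And>i. i < length v \<Longrightarrow> i \<notin> D \<Longrightarrow> w ! i = v ! i"
    and bij: "bij_betw ((!) w) D ((!) v ` D)" by (auto simp: refillings_def)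
  define p where "p i = (if i \<in> D then inv_into D ((!) v) (w ! i) else i)" for i
  have "bij_betw (inv_into D ((!) v) \<circ> (!) w) D D"
    using bij_betw_trans[OF bij bij_betw_inv_into[OF inj_on_imp_bij_betw[OF assms(1)]]] .
  moreover have "bij_betw p D D \<longleftrightarrow> bij_betw (inv_into D ((!) v) \<circ> (!) w) D D"
    by (intro bij_betw_cong) (auto simp: p_def)
  ultimately have "p permutes D"
    by (intro bij_imp_permutes) (auto simp: p_def)
  moreover have "w = map (\<lambda>i. v ! p i) [0..<length v]"
  proof (rule nth_equalityI)
    fix i assume i: "i < length w"
    show "w ! i = map (\<lambda>i. v ! p i) [0..<length v] ! i"
    proof (cases "i \<in> D")
      case True
      hence "w ! i \<in> (!) v ` D" using bij by (auto simp: bij_betw_def)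
      hence "v ! inv_into D ((!) v) (w ! i) = w ! i" by (rule f_inv_into_f)
      thus ?thesis using True i len by (simp add: p_def)
    next
      case False thus ?thesis using i len off by (simp add: p_def)
    qed
  qed (simp add: len)
  ultimately show "\<exists>p\<in>{p. p permutes D}. w = map (\<lambda>i. v ! p i) [0..<length v]" by blast
qed

lemma card_refillings:
  assumes "inj_on ((!) v) D" "D \<subseteq> {..<length v}"
  shows "card (refillings v D) = fact (card D)" "finite (refillings v D)"
proof -
  have D: "finite D" using assms(2) finite_subset by blast
  show "card (refillings v D) = fact (card D)"
    using bij_betw_same_card[OF refillings_eq_permutes[OF assms]] card_permutations[OF refl D] by simp
  show "finite (refillings v D)"
    using bij_betw_finite[OF refillings_eq_permutes[OF assms]] finite_permutations[OF D] by simp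
qed

text \<open>Fixing the cards on \<open>K\<close> leaves only the freedom to permute \<open>D - K\<close>; this turns the information
  gained from the hits on \<open>K\<close> into a factorial count.\<close>

lemma refillings_narrow:
  assumes "w \<in> refillings v D" "u \<in> refillings v D" "K \<subseteq> D" "\<And>i. i \<in> K \<Longrightarrow> w ! i = u ! i"
  shows "w \<in> refillings u (D - K)"
proof -
  have bw: "bij_betw ((!) w) D ((!) v ` D)" and bu: "bij_betw ((!) u) D ((!) v ` D)"
    using assms(1,2) by (auto simp: refillings_def)
  have im: "(!) w ` K = (!) u ` K" using assms(4) by auto
  have "(!) w ` (D - K) = (!) u ` (D - K)"
    using bw bu im assms(3) by (simp add: bij_betw_def inj_on_image_set_diff[of _ D])
  moreover have "inj_on ((!) w) (D - K)" using bw by (auto simp: bij_betw_def inj_on_def)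
  ultimately show ?thesis
    using assms by (auto simp: refillings_def bij_betw_def)
qed

section \<open>The player against a single permutation\<close>

definition first_hits :: "'s player \<Rightarrow> 's \<Rightarrow> nat list \<Rightarrow> nat set \<Rightarrow> nat set \<Rightarrow> bool" where
  "first_hits A s w T K \<longleftrightarrow> K \<subseteq> hits A s w \<inter> T \<and> (\<forall>t \<in> hits A s w \<inter> T - K. \<forall>r\<in>K. r < t)"

lemma initial_segment_of_card:
  fixes X :: "nat set"
  assumes "finite X" "k \<le> card X"
  shows "\<exists>K\<subseteq>X. card K = k \<and> (\<forall>t\<in>X - K. \<forall>r\<in>K. r < t)"
  using assms(2)
proof (induction k)
  case 0 thus ?case by (intro exI[of _ "{}"]) auto
next
  case (Suc k)
  hence "k \<le> card X" by simp
  from Suc.IH[OF this] obtain K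
    where K: "K \<subseteq> X" "card K = k" "\<forall>t\<in>X - K. \<forall>r\<in>K. r < t" by blast
  have fK: "finite K" using K assms finite_subset by blast
  have ne: "X - K \<noteq> {}"
  proof
    assume "X - K = {}"
    hence "card X \<le> card K" using fK by (intro card_mono) auto
    thus False using K(2) Suc.prems by simp
  qed
  let ?x = "Min (X - K)"
  have x: "?x \<in> X - K" using ne assms(1) by (intro Min_in) auto
  have "?x < t" if "t \<in> X - K" "t \<noteq> ?x" for t
  proof -
    have "?x \<le> t" using that(1) assms(1) by (intro Min_le) auto
    thus ?thesis using that(2) by simp
  qed
  hence "\<forall>t\<in>X - insert ?x K. \<forall>r\<in>insert ?x K. r < t" using K(3) by blast
  moreover have "card (insert ?x K) = Suc k" using x fK K(2) by (metis DiffD2 card_insert_disjoint)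
  moreover have "insert ?x K \<subseteq> X" using x K(1) by blast
  ultimately show ?case by blast
qed

text \<open>The set \<open>K\<close> of the first hit positions in \<open>T\<close> encodes all feedback up to its last element: a round
  outside \<open>T\<close> gives feedback on a card that is the same in all refillings, and a round in \<open>T\<close> before
  the last element of \<open>K\<close> is a hit exactly if it lies in \<open>K\<close>. So the history, hence every guess up to
  that point, depends on \<open>K\<close> only, and on \<open>K\<close> the cards are the guesses.\<close>

lemma first_hits_determine_cards:
  assumes w: "w \<in> refillings v T" and u: "u \<in> refillings v T"
    and fw: "first_hits A s w T K" and fu: "first_hits A s u T K" and "r \<in> K"
  shows "w ! r = u ! r"
proof -
  have len: "length w = length v" "length u = length v" using w u by (auto simp: refillings_def)
  have K: "K \<subseteq> hits A s w" "K \<subseteq> hits A s u" using fw fu by (auto simp: first_hits_def)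
  have same_history: "play A s w t = play A s u t" if "t \<le> r" "r \<in> K" for t r
    using that
  proof (induction t)
    case (Suc t)
    hence IH: "play A s w t = play A s u t" by simp
    have "t < r" using Suc.prems(1) by simp
    moreover have "r \<in> hits A s w" using K(1) Suc.prems(2) by blast
    hence "r < length v" using len(1) by (simp add: hits_def)
    ultimately have t: "t < r" "t < length v" by simp_all
    have "guess A s w t = w ! t \<longleftrightarrow> guess A s u t = u ! t"
    proof (cases "t \<in> T")
      case True
      have "t \<in> hits A s w \<longleftrightarrow> t \<in> K"
      proof
        assume "t \<in> hits A s w"
        thus "t \<in> K" using fw True t(1) Suc.prems(2) less_asym[of t r]
          unfolding first_hits_def by blast
      qed (use fw in \<open>auto simp: first_hits_def\<close>)
      moreover have "t \<in> hits A s u \<longleftrightarrow> t \<in> K"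
      proof
        assume "t \<in> hits A s u"
        thus "t \<in> K" using fu True t(1) Suc.prems(2) less_asym[of t r]
          unfolding first_hits_def by blast
      qed (use fu in \<open>auto simp: first_hits_def\<close>)
      ultimately have "t \<in> hits A s w \<longleftrightarrow> t \<in> hits A s u" by simp
      thus ?thesis using t(2) len by (simp add: hits_def)
    next
      case False
      hence "w ! t = u ! t" using w u t(2) by (simp add: refillings_def)
      thus ?thesis using IH by (simp add: guess_def)
    qed
    thus ?case using IH by (simp add: Let_def guess_def)
  qed simp
  have "w ! r = guess A s w r" "u ! r = guess A s u r"
    using subsetD[OF K(1) \<open>r \<in> K\<close>] subsetD[OF K(2) \<open>r \<in> K\<close>] by (simp_all add: hits_def)
  thus ?thesis using same_history[of r r] \<open>r \<in> K\<close> by (simp add: guess_def)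
qed

text \<open>There are \<open>card T choose k\<close> candidates for the first \<open>k\<close> hit positions, and each of them fixes the
  cards there and so leaves at most \<open>fact (card T - k)\<close> refillings. The product of the two numbers is
  \<open>fact (card T) / fact k\<close>.\<close>

lemma card_refillings_many_hits:
  assumes inj: "inj_on ((!) v) T" and T: "T \<subseteq> {..<length v}" and k: "k \<le> card T"
  shows "card {w \<in> refillings v T. k \<le> card (hits A s w \<inter> T)} \<le> fact (card T) div fact k"
proof -
  have fT: "finite T" using T finite_subset by blast
  define R where "R K = {w \<in> refillings v T. first_hits A s w T K}" for K
  let ?\<K> = "{K. K \<subseteq> T \<and> card K = k}"
  have "{w \<in> refillings v T. k \<le> card (hits A s w \<inter> T)} \<subseteq> (\<Union>K\<in>?\<K>. R K)"
  proof
    fix w assume w: "w \<in> {w \<in> refillings v T. k \<le> card (hits A s w \<inter> T)}"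
    hence k': "k \<le> card (hits A s w \<inter> T)" by simp
    have "finite (hits A s w \<inter> T)" by simp
    from initial_segment_of_card[OF this k'] obtain K where "K \<subseteq> hits A s w \<inter> T" "card K = k"
        "\<forall>t\<in>hits A s w \<inter> T - K. \<forall>r\<in>K. r < t"
      by blast
    hence "K \<in> ?\<K>" "first_hits A s w T K" unfolding first_hits_def by blast+
    hence "K \<in> ?\<K>" "w \<in> R K" using w by (simp_all add: R_def)
    thus "w \<in> (\<Union>K\<in>?\<K>. R K)" by blast
  qed
  moreover have fin: "finite (\<Union>K\<in>?\<K>. R K)"
    using card_refillings(2)[OF inj T] fT by (auto simp: R_def)
  ultimately have "card {w \<in> refillings v T. k \<le> card (hits A s w \<inter> T)} \<le> card (\<Union>K\<in>?\<K>. R K)"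
    by (intro card_mono)
  also have "\<dots> \<le> (\<Sum>K\<in>?\<K>. card (R K))"
    using fT by (intro card_UN_le) auto
  also have "\<dots> \<le> (\<Sum>K\<in>?\<K>. fact (card T - k))"
  proof (rule sum_mono)
    fix K assume "K \<in> ?\<K>"
    hence K: "K \<subseteq> T" "card K = k" by auto
    show "card (R K) \<le> fact (card T - k)"
    proof (cases "R K = {}")
      case False
      then obtain u where u: "u \<in> R K" by blast
      hence u': "u \<in> refillings v T" by (simp add: R_def)
      have sub: "R K \<subseteq> refillings u (T - K)"
      proof
        fix w assume w: "w \<in> R K"
        show "w \<in> refillings u (T - K)"
        proof (rule refillings_narrow[OF _ u' K(1)])
          show "w \<in> refillings v T" using w by (simp add: R_def)
          show "w ! i = u ! i" if "i \<in> K" for i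
            using w u that by (intro first_hits_determine_cards[of w v T u A s K i]) (simp_all add: R_def)
        qed
      qed
      have inj': "inj_on ((!) u) (T - K)"
        using u' by (auto simp: refillings_def bij_betw_def inj_on_def)
      have T': "T - K \<subseteq> {..<length u}" using u' T by (auto simp: refillings_def)
      have "card (T - K) = card T - k" using K fT by (simp add: card_Diff_subset finite_subset)
      thus ?thesis
        using card_mono[OF card_refillings(2)[OF inj' T'] sub] card_refillings(1)[OF inj' T'] by simp
    qed simp
  qed
  also have "\<dots> = (card T choose k) * fact (card T - k)"
    using fT by (simp add: n_subsets)
  also have "\<dots> = fact (card T) div fact k"
  proof -
    have "fact (card T) = fact k * ((card T choose k) * fact (card T - k))"
      using binomial_fact_lemma[OF k] by (simp add: mult.commute mult.left_commute)
    thus ?thesis by simp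
  qed
  finally show ?thesis .
qed

text \<open>A nonnegative integer is the number of \<open>k \<ge> 1\<close> below or equal to it, so the tail bound
  \<open>1 / fact k\<close> for at least \<open>k\<close> hits sums up to a bound on the mean.\<close>

lemma sum_hits_refillings:
  assumes inj: "inj_on ((!) v) T" and T: "T \<subseteq> {..<length v}"
  shows "(\<Sum>w\<in>refillings v T. real (card (hits A s w \<inter> T)))
           \<le> real (card (refillings v T)) * (\<Sum>k=1..card T. 1 / fact k)"
proof -
  have fT: "finite T" using T finite_subset by blast
  have layers: "real (card (hits A s w \<inter> T)) = (\<Sum>k=1..card T. of_bool (k \<le> card (hits A s w \<inter> T)))" for w
  proof -
    have "card (hits A s w \<inter> T) \<le> card T" using fT by (intro card_mono) auto
    hence "{1..card T} \<inter> {k. k \<le> card (hits A s w \<inter> T)} = {1..card (hits A s w \<inter> T)}" by auto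
    thus ?thesis by (subst sum_of_bool_eq) (simp_all only: finite_atLeastAtMost card_atLeastAtMost diff_Suc_1 add_0_right One_nat_def)
  qed
  have "(\<Sum>w\<in>refillings v T. real (card (hits A s w \<inter> T)))
          = (\<Sum>k=1..card T. \<Sum>w\<in>refillings v T. of_bool (k \<le> card (hits A s w \<inter> T)))"
    unfolding layers by (rule sum.swap)
  also have "\<dots> = (\<Sum>k=1..card T. real (card {w \<in> refillings v T. k \<le> card (hits A s w \<inter> T)}))"
    using card_refillings(2)[OF assms] by (simp add: Collect_conj_eq)
  also have "\<dots> \<le> (\<Sum>k=1..card T. fact (card T) * (1 / fact k))"
  proof (rule sum_mono)
    fix k assume "k \<in> {1..card T}"
    hence k: "k \<le> card T" by simp
    have "real (card {w \<in> refillings v T. k \<le> card (hits A s w \<inter> T)}) \<le> real (fact (card T) div fact k)"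
      using card_refillings_many_hits[OF assms k] by (simp only: of_nat_le_iff)
    also have "\<dots> = fact (card T) * (1 / fact k)"
      using fact_dvd[OF k, where 'a = nat] by (simp add: real_of_nat_div)
    finally show "real (card {w \<in> refillings v T. k \<le> card (hits A s w \<inter> T)}) \<le> fact (card T) * (1 / fact k)" .
  qed
  also have "\<dots> = real (card (refillings v T)) * (\<Sum>k=1..card T. 1 / fact k)"
    by (simp add: card_refillings(1)[OF assms] sum_distrib_left)
  finally show ?thesis .
qed

section \<open>Averaging over transversals\<close>

lemma refillings_mset_eq:
  assumes "inj_on ((!) v) D" "D \<subseteq> {..<length v}" "w \<in> refillings v D"
  shows "mset w = mset v"
proof -
  obtain p where "p permutes D" "w = permute_list p v"
    using bij_betw_imp_surj_on[OF refillings_eq_permutes[OF assms(1,2)]] assms(3)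
    unfolding permute_list_def by blast
  thus ?thesis using permutes_subset[of p D "{..<length v}"] assms(2) by simp
qed

lemma deck_words_mset_cong:
  assumes "mset w = mset v" "v \<in> deck_words m n"
  shows "w \<in> deck_words m n"
proof -
  have "count_list w k = count_list v k" for k
    using assms(1) by (metis count_mset)
  thus ?thesis
    using assms mset_eq_setD[OF assms(1)] mset_eq_length[OF assms(1)] by (simp add: deck_words_def)
qed

lemma finite_deck_words: "finite (deck_words m n)"
proof (rule finite_subset)
  show "deck_words m n \<subseteq> {w. set w \<subseteq> {1..n} \<and> length w = m * n}"
    by (auto simp: deck_words_def)
qed (simp add: finite_lists_length_eq)

lemma deck_words_nonempty: "deck_words m n \<noteq> {}"
proof -
  let ?w = "concat (replicate m [1..<Suc n])"
  have "length ?w = m * n" by (simp add: length_concat sum_list_replicate)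
  moreover have "set ?w \<subseteq> {1..n}" by auto
  moreover have "count_list ?w k = m" if "k \<in> {1..n}" for k
  proof -
    have "count_list [1..<Suc n] k = 1"
      using that count_mset[of "[1..<Suc n]" k] distinct_count_atmost_1[of "[1..<Suc n]"] by auto
    thus ?thesis by (induction m) auto
  qed
  ultimately have "?w \<in> deck_words m n" by (simp add: deck_words_def)
  thus ?thesis by blast
qed

text \<open>A transversal picks one copy of every label. This is how a deck with several copies of each label is
  cut down to a permutation.\<close>

definition transversals :: "nat \<Rightarrow> nat list \<Rightarrow> nat set set" where
  "transversals n w = {T. T \<subseteq> {..<length w} \<and> bij_betw ((!) w) T {1..n}}"

definition label_positions :: "'a list \<Rightarrow> 'a \<Rightarrow> nat set" where
  "label_positions w i = {p. p < length w \<and> w ! p = i}"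

lemma finite_label_positions [simp]: "finite (label_positions w i)"
  by (simp add: label_positions_def)

lemma card_label_positions: "card (label_positions w i) = count_list w i"
proof -
  have "label_positions w i = {p. p < length w \<and> i = w ! p}" by (auto simp: label_positions_def)
  thus ?thesis by (simp add: count_list_eq_length_filter length_filter_conv_card)
qed

text \<open>A transversal is an independent choice of a position for every label, which makes sums over
  transversals factor over the labels.\<close>

lemma transversals_eq_PiE:
  "bij_betw (\<lambda>c. c ` {1..n}) (PiE {1..n} (label_positions w)) (transversals n w)"
proof (rule bij_betwI')
  fix c d assume c: "c \<in> PiE {1..n} (label_positions w)" and d: "d \<in> PiE {1..n} (label_positions w)"
  have wc: "w ! c i = i" and wd: "w ! d i = i" if "i \<in> {1..n}" for i
    using PiE_mem[OF c that] PiE_mem[OF d that] by (auto simp: label_positions_def)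
  show "c ` {1..n} = d ` {1..n} \<longleftrightarrow> c = d"
  proof
    assume eq: "c ` {1..n} = d ` {1..n}"
    show "c = d"
    proof (rule PiE_ext[OF c d])
      fix i assume i: "i \<in> {1..n}"
      hence "c i \<in> d ` {1..n}" using eq by blast
      then obtain j where j: "j \<in> {1..n}" "c i = d j" by blast
      thus "c i = d i" using wc[OF i] wd[OF j(1)] by simp
    qed
  qed simp
next
  fix c assume c: "c \<in> PiE {1..n} (label_positions w)"
  have c': "c i < length w" "w ! c i = i" if "i \<in> {1..n}" for i
    using PiE_mem[OF c that] by (auto simp: label_positions_def)
  have "bij_betw ((!) w) (c ` {1..n}) {1..n}"
    by (rule bij_betw_byWitness[where f' = c]) (use c' in auto)
  thus "c ` {1..n} \<in> transversals n w" using c' by (auto simp: transversals_def)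
next
  fix T assume T: "T \<in> transversals n w"
  hence bij: "bij_betw ((!) w) T {1..n}" and sub: "T \<subseteq> {..<length w}"
    by (auto simp: transversals_def)
  let ?c = "restrict (inv_into T ((!) w)) {1..n}"
  have im: "?c ` {1..n} = T"
    using bij_betw_imp_surj_on[OF bij_betw_inv_into[OF bij]] by simp
  moreover have "?c \<in> PiE {1..n} (label_positions w)"
  proof (rule PiE_I)
    fix i assume i: "i \<in> {1..n}"
    have "?c i \<in> T" using im i by blast
    moreover have "w ! ?c i = i" using i bij_betw_inv_into_right[OF bij i] by simp
    ultimately show "?c i \<in> label_positions w i" using sub by (auto simp: label_positions_def)
  qed (auto simp: restrict_def)
  ultimately show "\<exists>c\<in>PiE {1..n} (label_positions w). T = c ` {1..n}" by blast
qed

lemma sum_PiE_coordinate: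
  fixes f :: "'b \<Rightarrow> 'c :: comm_semiring_1"
  assumes "finite I" "i \<in> I" "\<And>x. x \<in> I \<Longrightarrow> finite (B x)"
  shows "(\<Sum>g\<in>PiE I B. f (g i)) = (\<Sum>y\<in>B i. f y) * (\<Prod>x\<in>I - {i}. of_nat (card (B x)))"
proof -
  let ?f = "\<lambda>x y. if x = i then f y else 1"
  have "(\<Prod>x\<in>I. ?f x (g x)) = f (g i)" for g
    using assms(1,2) by (simp add: prod.remove[of I i])
  hence "(\<Sum>g\<in>PiE I B. f (g i)) = (\<Sum>g\<in>PiE I B. \<Prod>x\<in>I. ?f x (g x))" by simp
  also have "\<dots> = (\<Prod>x\<in>I. \<Sum>y\<in>B x. ?f x y)"
    using assms by (intro prod_sum_PiE[symmetric]) auto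
  also have "\<dots> = (\<Sum>y\<in>B i. f y) * (\<Prod>x\<in>I - {i}. of_nat (card (B x)))"
    using assms(1,2) by (simp add: prod.remove[of I i])
  finally show ?thesis .
qed

lemma card_transversals:
  assumes "w \<in> deck_words m n"
  shows "card (transversals n w) = m ^ n"
proof -
  have "card (transversals n w) = card (PiE {1..n} (label_positions w))"
    using bij_betw_same_card[OF transversals_eq_PiE] by simp
  also have "\<dots> = m ^ n"
    using assms by (simp add: card_PiE card_label_positions deck_words_def)
  finally show ?thesis .
qed

text \<open>A uniformly random transversal contains each position with probability \<open>1 / m\<close>, so on average it
  meets \<open>H\<close> in \<open>card H / m\<close> positions. The equation is this fact multiplied by \<open>m * m ^ n\<close>.\<close>

lemma sum_card_Int_transversals:
  assumes w: "w \<in> deck_words m n" and H: "H \<subseteq> {..<length w}"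
  shows "m * (\<Sum>T\<in>transversals n w. card (H \<inter> T)) = m ^ n * card H"
proof -
  let ?I = "{1..n}" and ?P = "label_positions w"
  have fH: "finite H" using H finite_subset by blast
  have card_P: "card (?P i) = m" if "i \<in> ?I" for i
    using w that by (simp add: card_label_positions deck_words_def)
  have card_H: "(\<Sum>i\<in>?I. card (H \<inter> ?P i)) = card H"
  proof -
    have "w ! p \<in> ?I" if "p \<in> H" for p
      using w that H nth_mem[of p w] unfolding deck_words_def by blast
    hence "H = (\<Union>i\<in>?I. H \<inter> ?P i)" using H by (auto simp: label_positions_def)
    moreover have "card (\<Union>i\<in>?I. H \<inter> ?P i) = (\<Sum>i\<in>?I. card (H \<inter> ?P i))"
      by (intro card_UN_disjoint) (auto simp: label_positions_def)
    ultimately show ?thesis by simp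
  qed
  have hit_count: "card (H \<inter> c ` ?I) = (\<Sum>i\<in>?I. of_bool (c i \<in> H))" if c: "c \<in> PiE ?I ?P" for c
  proof -
    have "w ! c i = i" if "i \<in> ?I" for i
      using PiE_mem[OF c that] by (auto simp: label_positions_def)
    hence "inj_on c (?I \<inter> {i. c i \<in> H})" by (intro inj_on_inverseI[of _ "(!) w"]) auto
    moreover have "H \<inter> c ` ?I = c ` (?I \<inter> {i. c i \<in> H})" by auto
    ultimately show ?thesis by (simp add: card_image)
  qed
  \<comment> \<open>Split the intersection by labels: for label \<open>i\<close> only the choice \<open>c i\<close> matters, and the other
    labels contribute the factor \<open>m ^ (n - 1)\<close>.\<close>
  have "(\<Sum>T\<in>transversals n w. card (H \<inter> T)) = (\<Sum>c\<in>PiE ?I ?P. card (H \<inter> c ` ?I))"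
    by (rule sum.reindex_bij_betw[OF transversals_eq_PiE, symmetric])
  also have "\<dots> = (\<Sum>c\<in>PiE ?I ?P. \<Sum>i\<in>?I. of_bool (c i \<in> H))"
    using hit_count by (intro sum.cong) auto
  also have "\<dots> = (\<Sum>i\<in>?I. \<Sum>c\<in>PiE ?I ?P. of_bool (c i \<in> H))"
    by (rule sum.swap)
  also have "\<dots> = (\<Sum>i\<in>?I. card (H \<inter> ?P i) * m ^ (n - 1))"
  proof (rule sum.cong[OF refl])
    fix i assume i: "i \<in> ?I"
    have "(\<Sum>c\<in>PiE ?I ?P. of_bool (c i \<in> H))
            = (\<Sum>p\<in>?P i. of_bool (p \<in> H)) * (\<Prod>x\<in>?I - {i}. card (?P x))"
      using sum_PiE_coordinate[of ?I i ?P "\<lambda>p. of_bool (p \<in> H) :: nat"] i by simp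
    also have "(\<Sum>p\<in>?P i. of_bool (p \<in> H)) = card (H \<inter> ?P i)"
      by (simp add: Int_commute)
    also have "(\<Prod>x\<in>?I - {i}. card (?P x)) = m ^ (n - 1)"
      using card_P i by simp
    finally show "(\<Sum>c\<in>PiE ?I ?P. of_bool (c i \<in> H)) = card (H \<inter> ?P i) * m ^ (n - 1)" .
  qed
  also have "\<dots> = m ^ (n - 1) * card H"
    unfolding sum_distrib_right[symmetric] card_H by simp
  finally have "m * (\<Sum>T\<in>transversals n w. card (H \<inter> T)) = (m * m ^ (n - 1)) * card H"
    by simp
  moreover have "n = 0 \<Longrightarrow> card H = 0" using card_H by simp
  ultimately show ?thesis by (cases n) auto
qed

text \<open>Words that agree off \<open>T\<close> form a class that consists of all refillings of any of its members on \<open>T\<close>,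
  because a rearrangement within \<open>T\<close> keeps both the label counts and the transversality of \<open>T\<close>. The
  bound for a single permutation therefore applies to each class.\<close>

lemma sum_hits_common_transversal:
  fixes T :: "nat set" and m n :: nat
  defines "W \<equiv> {w \<in> deck_words m n. T \<in> transversals n w}"
  shows "(\<Sum>w\<in>W. real (card (hits A s w \<inter> T))) \<le> real (card W) * (\<Sum>k=1..n. 1 / fact k)"
proof -
  \<comment> \<open>The default label 0 just erases the cards on \<open>T\<close>, so that equal values of \<open>off\<close> mean agreement
    off \<open>T\<close>.\<close>
  define off where "off w = map (\<lambda>i. if i \<in> T then 0 else w ! i) [0..<length w]" for w :: "nat list"
  have fW: "finite W" using finite_deck_words by (simp add: W_def)
  have inj: "inj_on ((!) v) T" "T \<subseteq> {..<length v}" and im: "(!) v ` T = {1..n}"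
    if "v \<in> W" for v
    using that by (auto simp: W_def transversals_def bij_betw_def)
  have fiber: "{w \<in> W. off w = off v} = refillings v T" if v: "v \<in> W" for v
  proof (intro equalityI subsetI)
    fix w assume w: "w \<in> {w \<in> W. off w = off v}"
    hence "length w = length v" using v by (simp add: W_def deck_words_def)
    moreover have "w ! i = v ! i" if "i < length v" "i \<notin> T" for i
    proof -
      have "off w ! i = off v ! i" using w by simp
      thus ?thesis using that \<open>length w = length v\<close> by (simp add: off_def)
    qed
    moreover have "bij_betw ((!) w) T {1..n}" using w by (simp add: W_def transversals_def)
    ultimately show "w \<in> refillings v T" using im[OF v] by (simp add: refillings_def)
  next
    fix w assume w: "w \<in> refillings v T"
    have "mset w = mset v" using refillings_mset_eq[OF inj[OF v] w] .
    hence "w \<in> deck_words m n" using v deck_words_mset_cong by (auto simp: W_def)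
    moreover have len: "length w = length v" using w by (simp add: refillings_def)
    moreover have "bij_betw ((!) w) T {1..n}" using w im[OF v] by (simp add: refillings_def)
    moreover have "off w = off v" using w len by (auto simp: off_def refillings_def)
    ultimately show "w \<in> {w \<in> W. off w = off v}"
      using inj(2)[OF v] by (simp add: W_def transversals_def)
  qed
  have "(\<Sum>w\<in>W. real (card (hits A s w \<inter> T)))
          = (\<Sum>y\<in>off ` W. \<Sum>w\<in>{w \<in> W. off w = y}. real (card (hits A s w \<inter> T)))"
    by (rule sum.image_gen[OF fW])
  also have "\<dots> \<le> (\<Sum>y\<in>off ` W. real (card {w \<in> W. off w = y}) * (\<Sum>k=1..n. 1 / fact k))"
  proof (rule sum_mono)
    fix y assume "y \<in> off ` W"
    then obtain v where v: "v \<in> W" "y = off v" by blast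
    have "card T = n" using card_image[OF inj(1)[OF v(1)]] im[OF v(1)] by simp
    thus "(\<Sum>w\<in>{w \<in> W. off w = y}. real (card (hits A s w \<inter> T)))
            \<le> real (card {w \<in> W. off w = y}) * (\<Sum>k=1..n. 1 / fact k)"
      using sum_hits_refillings[OF inj[OF v(1)], of A s] unfolding v(2) fiber[OF v(1)] by simp
  qed
  also have "\<dots> = real (card W) * (\<Sum>k=1..n. 1 / fact k)"
    using sum.image_gen[OF fW, of "\<lambda>_. 1::real" off] by (simp add: sum_distrib_right)
  finally show ?thesis .
qed

text \<open>Count pairs of a deck and one of its transversals in both orders. With the deck outside, the hits on
  the transversal make up a fraction \<open>1 / m\<close> of the score; with the transversal outside, their mean is
  at most the sum of the inverse factorials.\<close>

lemma sum_score_deck_words_le: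
  assumes "m \<ge> 1"
  shows "(\<Sum>w\<in>deck_words m n. score A s w)
           \<le> real m * real (card (deck_words m n)) * (\<Sum>k=1..n. 1 / fact k)"
proof -
  let ?D = "deck_words m n" and ?e = "\<Sum>k=1..n. 1 / fact k :: real"
  let ?\<T> = "Pow {..<m * n}"
  have tr: "transversals n w = {T \<in> ?\<T>. T \<in> transversals n w}" if "w \<in> ?D" for w
    using that by (auto simp: transversals_def deck_words_def)
  have swap: "(\<Sum>w\<in>?D. \<Sum>T\<in>transversals n w. f w T)
                = (\<Sum>T\<in>?\<T>. \<Sum>w | w \<in> ?D \<and> T \<in> transversals n w. f w T)"
    for f :: "nat list \<Rightarrow> nat set \<Rightarrow> real"
  proof -
    have "(\<Sum>w\<in>?D. \<Sum>T\<in>transversals n w. f w T)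
            = (\<Sum>w\<in>?D. \<Sum>T | T \<in> ?\<T> \<and> T \<in> transversals n w. f w T)"
      using tr by (intro sum.cong) simp_all
    also have "\<dots> = (\<Sum>T\<in>?\<T>. \<Sum>w | w \<in> ?D \<and> T \<in> transversals n w. f w T)"
      by (rule sum.swap_restrict) (simp_all add: finite_deck_words)
    finally show ?thesis .
  qed
  have "real (m ^ n) * (\<Sum>w\<in>?D. score A s w)
          = (\<Sum>w\<in>?D. real (m ^ n * card (hits A s w)))"
    by (simp add: score_eq_card_hits sum_distrib_left)
  also have "\<dots> = (\<Sum>w\<in>?D. real (m * (\<Sum>T\<in>transversals n w. card (hits A s w \<inter> T))))"
  proof (rule sum.cong[OF refl])
    fix w assume "w \<in> ?D"
    moreover have "hits A s w \<subseteq> {..<length w}" by (auto simp: hits_def)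
    ultimately show "real (m ^ n * card (hits A s w))
        = real (m * (\<Sum>T\<in>transversals n w. card (hits A s w \<inter> T)))"
      by (simp only: sum_card_Int_transversals)
  qed
  also have "\<dots> = real m * (\<Sum>w\<in>?D. \<Sum>T\<in>transversals n w. real (card (hits A s w \<inter> T)))"
    by (simp add: sum_distrib_left)
  also have "\<dots> = real m * (\<Sum>T\<in>?\<T>. \<Sum>w | w \<in> ?D \<and> T \<in> transversals n w. real (card (hits A s w \<inter> T)))"
    by (simp only: swap)
  also have "\<dots> \<le> real m * (\<Sum>T\<in>?\<T>. real (card {w \<in> ?D. T \<in> transversals n w}) * ?e)"
    by (intro mult_left_mono sum_mono sum_hits_common_transversal) simp
  also have "\<dots> = real m * ((\<Sum>w\<in>?D. \<Sum>T\<in>transversals n w. 1) * ?e)"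
    unfolding swap by (simp add: sum_distrib_right)
  also have "(\<Sum>w\<in>?D. \<Sum>T\<in>transversals n w. 1) = real (m ^ n) * real (card ?D)"
    using card_transversals by simp
  finally have "real (m ^ n) * (\<Sum>w\<in>?D. score A s w) \<le> real (m ^ n) * (real m * real (card ?D) * ?e)"
    by (simp add: mult_ac)
  moreover have "real (m ^ n) > 0" using assms by simp
  ultimately show ?thesis by (simp only: mult_le_cancel_left_pos)
qed

text \<open>By Fubini the bound for every fixed seed passes to the expectation. If the score is not integrable,
  the integral is 0 by convention, and the bound holds trivially.\<close>

lemma expected_score_le:
  assumes "m \<ge> 1" "strategy n M A"
  shows "expected_score m n M A \<le> real m * (\<Sum>k=1..n. 1 / fact k)"
proof -
  let ?Q = "measure_pmf (pmf_of_set (deck_words m n))"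
  let ?f = "\<lambda>(s, w). score A s w"
  have e: "0 \<le> real m * (\<Sum>k=1..n. 1 / fact k)" by (intro mult_nonneg_nonneg sum_nonneg) auto
  interpret M: prob_space M using assms(2) by (simp add: strategy_def)
  interpret Q: prob_space ?Q by (rule prob_space_measure_pmf)
  interpret pair_sigma_finite M ?Q ..
  show ?thesis
  proof (cases "integrable (M \<Otimes>\<^sub>M ?Q) ?f")
    case True
    have inner: "(\<integral>w. score A s w \<partial>?Q) \<le> real m * (\<Sum>k=1..n. 1 / fact k)" for s
    proof -
      have "(\<integral>w. score A s w \<partial>?Q) = (\<Sum>w\<in>deck_words m n. score A s w) / card (deck_words m n)"
        by (rule integral_pmf_of_set[OF deck_words_nonempty finite_deck_words])
      moreover have "card (deck_words m n) > 0"
        using deck_words_nonempty finite_deck_words by (simp add: card_gt_0_iff)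
      ultimately show ?thesis
        using sum_score_deck_words_le[OF assms(1), of A s n]
        by (simp add: pos_divide_le_eq mult_ac del: integral_pmf_of_set)
    qed
    have "expected_score m n M A = (\<integral>s. (\<integral>w. score A s w \<partial>?Q) \<partial>M)"
      using integral_fst'[OF True] by (simp add: expected_score_def)
    also have "\<dots> \<le> real m * (\<Sum>k=1..n. 1 / fact k)"
      using integrable_fst'[OF True] inner by (intro M.integral_le_const) auto
    finally show ?thesis .
  next
    case False
    thus ?thesis using e by (simp add: expected_score_def not_integrable_integral_eq)
  qed
qed

section \<open>Guessing one label at a time\<close>

text \<open>The next label is one more than the number of hits so far. The minimum keeps the guess a label after
  all labels have been hit.\<close>

definition one_label_at_a_time :: "nat \<Rightarrow> history \<Rightarrow> nat" where
  "one_label_at_a_time n h = min n (Suc (length (filter snd h)))"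

lemma score_eq_history: "score A s w = length (filter snd (play A s w (length w)))"
proof -
  have "real (length (filter snd (play A s w t))) = (\<Sum>i<t. of_bool (guess A s w i = w ! i))" for t
    by (induction t) (simp_all add: Let_def guess_def)
  thus ?thesis by (simp add: score_def)
qed

text \<open>The number of hits never falls behind the number of labels from \<open>{1..k}\<close> seen so far: if the two are
  equal when the next such label shows up, then this label is exactly the current guess.\<close>

lemma score_ge_if_ordered:
  assumes w: "set w \<subseteq> {1..n}" and ord: "filter (\<lambda>x. x \<le> k) w = [1..<Suc k]"
  shows "real k \<le> score (\<lambda>_. one_label_at_a_time n) s w"
proof -
  let ?A = "\<lambda>_. one_label_at_a_time n"
  let ?c = "\<lambda>t. length (filter snd (play ?A s w t))"
  let ?j = "\<lambda>t. length (filter (\<lambda>x. x \<le> k) (take t w))"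
  have "?j t \<le> ?c t" if "t \<le> length w" for t
    using that
  proof (induction t)
    case (Suc t)
    hence t: "t < length w" and IH: "?j t \<le> ?c t" by simp_all
    have step: "?c (Suc t) = ?c t + of_bool (min n (Suc (?c t)) = w ! t)"
      by (simp add: Let_def one_label_at_a_time_def)
    show ?case
    proof (cases "w ! t \<le> k")
      case True
      have "[1..<Suc k] = filter (\<lambda>x. x \<le> k) (take t w @ w ! t # drop (Suc t) w)"
        using ord id_take_nth_drop[OF t] by simp
      hence eq: "[1..<Suc k] = filter (\<lambda>x. x \<le> k) (take t w) @ w ! t # filter (\<lambda>x. x \<le> k) (drop (Suc t) w)"
        using True by simp
      hence "length [1..<Suc k] > ?j t" by simp
      hence "[1..<Suc k] ! ?j t = Suc (?j t)" by (simp del: upt_Suc)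
      hence next_label: "w ! t = Suc (?j t)" using eq by (simp del: upt_Suc)
      have "w ! t \<le> n" using w t nth_mem by fastforce
      have "?j (Suc t) = Suc (?j t)" using t True by (simp add: take_Suc_conv_app_nth)
      moreover have "Suc (?j t) \<le> ?c (Suc t)"
      proof (cases "?j t = ?c t")
        case True
        hence "min n (Suc (?c t)) = w ! t" using next_label \<open>w ! t \<le> n\<close> by simp
        thus ?thesis using step True by simp
      next
        case False thus ?thesis using IH step by simp
      qed
      ultimately show ?thesis by simp
    next
      case False
      hence "?j (Suc t) = ?j t" using t by (simp add: take_Suc_conv_app_nth)
      thus ?thesis using IH step by simp
    qed
  qed simp
  from this[of "length w"] have "length (filter (\<lambda>x. x \<le> k) w) \<le> ?c (length w)" by simp
  thus ?thesis unfolding score_eq_history ord by (simp del: upt_Suc)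
qed

text \<open>For a uniformly random permutation, the labels \<open>1, \<dots>, k\<close> appear in increasing order with
  probability at least \<open>1 / fact k\<close>, since every permutation arises from an ordered one by permuting the
  names of these labels.\<close>

lemma card_deck_words_le_ordered:
  assumes "k \<le> n"
  shows "card (deck_words 1 n) \<le> card {w \<in> deck_words 1 n. filter (\<lambda>x. x \<le> k) w = [1..<Suc k]} * fact k"
proof -
  let ?D = "deck_words 1 n"
  let ?G = "{w \<in> ?D. filter (\<lambda>x. x \<le> k) w = [1..<Suc k]}"
  let ?P = "{\<sigma>. \<sigma> permutes {1..k}}"
  have "?D \<subseteq> (\<lambda>(v, \<sigma>). map \<sigma> v) ` (?G \<times> ?P)"
  proof
    fix w assume w: "w \<in> ?D"
    hence set_sub: "set w \<subseteq> {1..n}" and count: "\<And>i. i \<in> {1..n} \<Longrightarrow> count_list w i = 1"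
      by (auto simp: deck_words_def)
    have set_w: "set w = {1..n}"
    proof
      show "{1..n} \<subseteq> set w"
      proof
        fix i assume "i \<in> {1..n}"
        hence "count_list w i \<noteq> 0" using count by simp
        thus "i \<in> set w" by (simp add: count_list_0_iff)
      qed
    qed (rule set_sub)
    have "distinct w"
      unfolding distinct_count_atmost_1
    proof
      fix i
      show "count (mset w) i = (if i \<in> set w then 1 else 0)"
        using count[of i] set_w by (cases "i \<in> set w") (simp_all add: count_mset)
    qed
    define L where "L = filter (\<lambda>x. x \<le> k) w"
    have L: "distinct L" "set L = {1..k}"
      using \<open>distinct w\<close> set_w assms by (auto simp: L_def)
    have len_L: "length L = k" using distinct_card[OF L(1)] L(2) by simp
    \<comment> \<open>\<open>\<sigma>\<close> sends \<open>j\<close> to the \<open>j\<close>-th label from \<open>{1..k}\<close> in order of appearance (lists count from 0), so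
      its inverse renames these labels into increasing order.\<close>
    define \<sigma> where "\<sigma> j = (if j \<in> {1..k} then L ! (j - 1) else j)" for j
    have "bij_betw (\<lambda>j. j - 1) {1..k} {..<k}"
      by (rule bij_betw_byWitness[where f' = Suc]) auto
    moreover have "bij_betw ((!) L) {..<k} {1..k}"
      using bij_betw_nth[OF L(1)] len_L L(2) by simp
    ultimately have "bij_betw ((!) L \<circ> (\<lambda>j. j - 1)) {1..k} {1..k}"
      by (rule bij_betw_trans)
    moreover have "bij_betw \<sigma> {1..k} {1..k} \<longleftrightarrow> bij_betw ((!) L \<circ> (\<lambda>j. j - 1)) {1..k} {1..k}"
      by (rule bij_betw_cong) (simp add: \<sigma>_def)
    ultimately have \<sigma>: "\<sigma> permutes {1..k}"
      by (intro bij_imp_permutes) (auto simp: \<sigma>_def)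
    hence \<sigma>n: "\<sigma> permutes {1..n}" using assms by (intro permutes_subset[OF \<sigma>]) auto
    note inv = permutes_inv[OF \<sigma>] and inv_n = permutes_inv[OF \<sigma>n]
    define v where "v = map (inv \<sigma>) w"
    have "v \<in> ?D"
    proof -
      have "set v = {1..n}" using set_w permutes_image[OF inv_n] by (simp add: v_def)
      moreover have "count_list v i = 1" if "i \<in> {1..n}" for i
      proof -
        have "count_list (map (inv \<sigma>) w) (inv \<sigma> (\<sigma> i)) = count_list w (\<sigma> i)"
          by (rule count_list_map_conv[OF permutes_inj[OF inv]])
        thus ?thesis
          using count[of "\<sigma> i"] that permutes_in_image[OF \<sigma>n, of i]
          by (simp add: v_def permutes_inverses(2)[OF \<sigma>])
      qed
      moreover have "length v = 1 * n" using w by (simp add: v_def deck_words_def)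
      ultimately show ?thesis by (simp add: deck_words_def)
    qed
    moreover have "filter (\<lambda>x. x \<le> k) v = [1..<Suc k]"
    proof -
      have "inv \<sigma> x \<le> k \<longleftrightarrow> x \<le> k" if "x \<in> set w" for x
        using that set_w permutes_in_image[OF inv, of x] permutes_in_image[OF inv_n, of x] by auto
      hence "filter (\<lambda>x. x \<le> k) v = map (inv \<sigma>) L"
        unfolding v_def L_def filter_map o_def by (auto cong: filter_cong)
      also have "\<dots> = [1..<Suc k]"
      proof (rule nth_equalityI)
        fix i assume "i < length (map (inv \<sigma>) L)"
        hence "i < k" using len_L by simp
        moreover from this have "\<sigma> (Suc i) = L ! i" by (simp add: \<sigma>_def)
        hence "inv \<sigma> (L ! i) = Suc i" using permutes_inverses(2)[OF \<sigma>] by metis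
        ultimately show "map (inv \<sigma>) L ! i = [1..<Suc k] ! i"
          using len_L by (simp del: upt_Suc)
      qed (simp add: len_L)
      finally show ?thesis .
    qed
    moreover have "w = map \<sigma> v"
      by (simp add: v_def o_def permutes_inverses(1)[OF \<sigma>])
    ultimately show "w \<in> (\<lambda>(v, \<sigma>). map \<sigma> v) ` (?G \<times> ?P)"
      using \<sigma> by (intro image_eqI[of _ _ "(v, \<sigma>)"]) auto
  qed
  moreover have fin: "finite (?G \<times> ?P)"
    by (intro finite_cartesian_product finite_permutations) (simp_all add: finite_deck_words del: upt_Suc)
  ultimately have "card ?D \<le> card (?G \<times> ?P)" by (rule surj_card_le[rotated])
  also have "\<dots> = card ?G * fact k"
    using card_permutations[of "{1..k}" k] by (simp add: card_cartesian_product)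
  finally show ?thesis .
qed

lemma sum_score_one_label_ge:
  "real (card (deck_words 1 n)) * (\<Sum>k=1..n. 1 / fact k)
     \<le> (\<Sum>w\<in>deck_words 1 n. score (\<lambda>_. one_label_at_a_time n) s w)"
proof -
  let ?D = "deck_words 1 n" and ?ord = "\<lambda>k w. filter (\<lambda>x. x \<le> k) w = [1..<Suc k]"
  let ?A = "\<lambda>_. one_label_at_a_time n"
  have "real (card ?D) * (\<Sum>k=1..n. 1 / fact k) = (\<Sum>k=1..n. real (card ?D) / fact k)"
    by (simp add: sum_distrib_left)
  also have "\<dots> \<le> (\<Sum>k=1..n. real (card {w \<in> ?D. ?ord k w}))"
  proof (rule sum_mono)
    fix k assume "k \<in> {1..n}"
    hence "real (card ?D) \<le> real (card {w \<in> ?D. ?ord k w} * fact k)"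
      using card_deck_words_le_ordered[of k n] by (simp only: of_nat_le_iff atLeastAtMost_iff)
    thus "real (card ?D) / fact k \<le> real (card {w \<in> ?D. ?ord k w})"
      by (simp add: pos_divide_le_eq)
  qed
  also have "\<dots> = (\<Sum>k=1..n. \<Sum>w\<in>?D. of_bool (?ord k w))"
    using finite_deck_words by (simp add: Collect_conj_eq del: upt_Suc)
  also have "\<dots> = (\<Sum>w\<in>?D. \<Sum>k=1..n. of_bool (?ord k w))"
    by (rule sum.swap)
  also have "\<dots> \<le> (\<Sum>w\<in>?D. score ?A s w)"
  proof (rule sum_mono)
    fix w assume "w \<in> ?D"
    hence w: "set w \<subseteq> {1..n}" by (simp add: deck_words_def)
    have "{1..n} \<inter> {k. ?ord k w} \<subseteq> {1..card (hits ?A s w)}"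
    proof
      fix k assume k: "k \<in> {1..n} \<inter> {k. ?ord k w}"
      hence "?ord k w" by (simp only: Int_iff mem_Collect_eq)
      hence "k \<le> card (hits ?A s w)"
        by (rule score_ge_if_ordered[OF w, unfolded score_eq_card_hits of_nat_le_iff])
      moreover have "1 \<le> k" using k by (simp only: Int_iff atLeastAtMost_iff)
      ultimately show "k \<in> {1..card (hits ?A s w)}" by simp
    qed
    hence "card ({1..n} \<inter> {k. ?ord k w}) \<le> card {1..card (hits ?A s w)}"
      by (rule card_mono[rotated]) simp
    thus "(\<Sum>k=1..n. of_bool (?ord k w)) \<le> score ?A s w"
      by (simp add: score_eq_card_hits del: upt_Suc)
  qed
  finally show ?thesis .
qed

lemma score_one_label_single:
  assumes "w \<in> deck_words m 1"
  shows "score (\<lambda>_. one_label_at_a_time 1) s w = real m"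
proof -
  have "w ! t = 1" if "t < length w" for t
    using assms nth_mem[OF that] by (auto simp: deck_words_def)
  hence "score (\<lambda>_. one_label_at_a_time 1) s w = (\<Sum>t<length w. 1)"
    unfolding score_def by (intro sum.cong) (simp_all add: guess_def one_label_at_a_time_def)
  thus ?thesis using assms by (simp add: deck_words_def)
qed

section \<open>The optimal expected score\<close>

text \<open>The two seeds may have different types, so that the score of a deterministic player can be computed
  without reference to the seed type.\<close>

lemma score_seedless:
  fixes s :: 's and s' :: 'r
  shows "score (\<lambda>_ :: 's. a) s w = score (\<lambda>_ :: 'r. a) s' w"
proof -
  have "play (\<lambda>_ :: 's. a) s w t = play (\<lambda>_ :: 'r. a) s' w t" for t
    by (induction t) (simp_all add: Let_def)
  thus ?thesis by (simp add: score_def guess_def)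
qed

text \<open>The score does not depend on the seed, so only the marginal law of the deck matters.\<close>

lemma expected_score_seedless:
  assumes "prob_space M"
  shows "expected_score m n M (\<lambda>_. a)
           = (\<Sum>w\<in>deck_words m n. score (\<lambda>_. a) s w) / real (card (deck_words m n))"
proof -
  let ?Q = "measure_pmf (pmf_of_set (deck_words m n))"
  interpret M: prob_space M by fact
  have marginal: "distr (M \<Otimes>\<^sub>M ?Q) ?Q snd = ?Q"
  proof (rule measure_eqI)
    fix X assume "X \<in> sets (distr (M \<Otimes>\<^sub>M ?Q) ?Q snd)"
    have "emeasure (distr (M \<Otimes>\<^sub>M ?Q) ?Q snd) X
            = emeasure (M \<Otimes>\<^sub>M ?Q) (space M \<times> X)"
      by (subst emeasure_distr)
         (auto simp: space_pair_measure intro!: arg_cong[where f = "emeasure (M \<Otimes>\<^sub>M ?Q)"])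
    thus "emeasure (distr (M \<Otimes>\<^sub>M ?Q) ?Q snd) X = emeasure ?Q X"
      by (simp add: measure_pmf.emeasure_pair_measure_Times M.emeasure_space_1)
  qed simp
  have "expected_score m n M (\<lambda>_. a) = (\<integral>x. score (\<lambda>_. a) s (snd x) \<partial>(M \<Otimes>\<^sub>M ?Q))"
    unfolding expected_score_def
    unfolding case_prod_unfold
    by (intro Bochner_Integration.integral_cong refl score_seedless)
  also have "\<dots> = (\<integral>w. score (\<lambda>_. a) s w \<partial>distr (M \<Otimes>\<^sub>M ?Q) ?Q snd)"
    by (subst integral_distr) auto
  also have "\<dots> = (\<integral>w. score (\<lambda>_. a) s w \<partial>?Q)"
    by (simp only: marginal)
  also have "\<dots> = (\<Sum>w\<in>deck_words m n. score (\<lambda>_. a) s w) / real (card (deck_words m n))"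
    by (rule integral_pmf_of_set[OF deck_words_nonempty finite_deck_words])
  finally show ?thesis .
qed

lemma strategy_one_label_at_a_time:
  assumes "n \<ge> 1" "prob_space M"
  shows "strategy n M (\<lambda>_. one_label_at_a_time n)"
  using assms by (auto simp: strategy_def one_label_at_a_time_def)

lemma Pplus_bounds:
  fixes T :: "'s itself"
  assumes "m \<ge> 1" "n \<ge> 1"
  shows Pplus_le: "Pplus T m n \<le> real m * (\<Sum>k=1..n. 1 / fact k)"
    and Pplus_ge: "(\<Sum>w\<in>deck_words m n. score (\<lambda>_. one_label_at_a_time n) () w)
                     / real (card (deck_words m n)) \<le> Pplus T m n"
proof -
  let ?S = "{expected_score m n M A | (M :: 's measure) (A :: 's player). strategy n M A}"
  let ?A = "\<lambda>_. one_label_at_a_time n"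
  obtain M :: "'s measure" where M: "prob_space M"
    using prob_space_return[of undefined "count_space UNIV"] by auto
  have bound: "x \<le> real m * (\<Sum>k=1..n. 1 / fact k)" if "x \<in> ?S" for x
    using that expected_score_le[OF assms(1)] by blast
  have elem: "expected_score m n M ?A \<in> ?S"
    using strategy_one_label_at_a_time[OF assms(2) M] by blast
  show "Pplus T m n \<le> real m * (\<Sum>k=1..n. 1 / fact k)"
    unfolding Pplus_def by (rule cSup_least) (use bound elem in blast)+
  have "expected_score m n M ?A \<le> Pplus T m n"
    unfolding Pplus_def by (rule cSup_upper[OF elem]) (use bound in \<open>auto simp: bdd_above_def\<close>)
  thus "(\<Sum>w\<in>deck_words m n. score ?A () w) / real (card (deck_words m n)) \<le> Pplus T m n"
    by (simp only: expected_score_seedless[OF M, of m n "one_label_at_a_time n" "()"])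
qed

lemma Pplus_div_le:
  assumes "m \<ge> 1" "n \<ge> 1"
  shows "Pplus T m n / real m \<le> (\<Sum>k=1..n. 1 / fact k)"
proof -
  have "0 < real m" using assms(1) by simp
  thus ?thesis using Pplus_le[OF assms, of T] by (simp only: pos_divide_le_eq mult.commute)
qed

lemma sums_inverse_fact: "(\<lambda>k. 1 / fact (Suc k)) sums (exp 1 - 1 :: real)"
proof -
  have "(\<lambda>k. 1 / fact k :: real) sums exp 1"
    using exp_converges[of "1::real"] by (simp add: divide_inverse)
  thus ?thesis using sums_Suc_iff[of "\<lambda>k. 1 / fact k :: real" "exp 1 - 1"] by simp
qed

lemma sum_inverse_fact_less: "(\<Sum>k=1..n. 1 / fact k) < exp (1::real) - 1"
proof -
  have "(\<Sum>k<n. 1 / fact (Suc k)) < (\<Sum>k. 1 / fact (Suc k) :: real)"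
    using sums_summable[OF sums_inverse_fact] by (intro sum_less_suminf) auto
  thus ?thesis
    using sums_unique[OF sums_inverse_fact] by (simp add: sum.atLeast1_atMost_eq del: fact_Suc)
qed

lemma sum_inverse_fact_tendsto: "(\<lambda>n. \<Sum>k=1..n. 1 / fact k) \<longlonglongrightarrow> exp (1::real) - 1"
  using sums_inverse_fact by (simp add: sums_def sum.atLeast1_atMost_eq del: fact_Suc)

text \<open>In both cases guessing one label at a time attains the upper bound: for \<open>m = 1\<close> by the count of
  ordered permutations, and for \<open>n = 1\<close> because every guess is then correct.\<close>

lemma Pplus_eq:
  assumes "m \<ge> 1" "n \<ge> 1" "m = 1 \<or> n = 1"
  shows "Pplus T m n / real m = (\<Sum>k=1..n. 1 / fact k)"
proof -
  let ?D = "deck_words m n" and ?e = "\<Sum>k=1..n. 1 / fact k :: real"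
  have D: "0 < real (card ?D)"
    using finite_deck_words deck_words_nonempty by (simp add: card_gt_0_iff)
  have "real m * ?e * real (card ?D) \<le> (\<Sum>w\<in>?D. score (\<lambda>_. one_label_at_a_time n) () w)"
  proof (cases "m = 1")
    case True
    thus ?thesis using sum_score_one_label_ge[of n "()"] by (simp add: mult.commute)
  next
    case False
    hence "n = 1" using assms(3) by simp
    hence "(\<Sum>w\<in>?D. score (\<lambda>_. one_label_at_a_time n) () w) = (\<Sum>w\<in>?D. real m)"
      using score_one_label_single by (intro sum.cong) simp_all
    thus ?thesis using \<open>n = 1\<close> by (simp add: mult.commute)
  qed
  hence "real m * ?e \<le> (\<Sum>w\<in>?D. score (\<lambda>_. one_label_at_a_time n) () w) / real (card ?D)"
    using D by (simp only: pos_le_divide_eq)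
  hence "real m * ?e \<le> Pplus T m n"
    using Pplus_ge[OF assms(1,2), of T] by (rule order_trans)
  hence "Pplus T m n = real m * ?e" using Pplus_le[OF assms(1,2), of T] by simp
  thus ?thesis using assms(1) by simp
qed

theorem theorem1p2:
  "(\<forall>m\<ge>1. \<forall>n\<ge>1.
      Pplus TYPE('s) m n / real m \<le> (\<Sum>k=1..n. 1 / fact k) \<and>
      (\<Sum>k=1..n. 1 / fact k) < exp (1::real) - 1) \<and>
   (\<forall>m\<ge>1. \<forall>n\<ge>1. m = 1 \<or> n = 1 \<longrightarrow>
      Pplus TYPE('s) m n / real m = (\<Sum>k=1..n. 1 / fact k)) \<and>
   (SUP (m, n) \<in> {1..} \<times> {1..}. Pplus TYPE('s) m n / real m) = exp 1 - 1"
proof (intro conjI allI impI)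
  fix m n :: nat assume "m \<ge> 1" "n \<ge> 1"
  thus upper: "Pplus TYPE('s) m n / real m \<le> (\<Sum>k=1..n. 1 / fact k)"
    by (rule Pplus_div_le)
  show "(\<Sum>k=1..n. 1 / fact k) < exp (1::real) - 1" by (rule sum_inverse_fact_less)
next
  fix m n :: nat assume "m \<ge> 1" "n \<ge> 1" "m = 1 \<or> n = 1"
  thus "Pplus TYPE('s) m n / real m = (\<Sum>k=1..n. 1 / fact k)" by (rule Pplus_eq)
next
  let ?f = "\<lambda>(m, n). Pplus TYPE('s) m n / real m"
  have upper: "?f x \<le> exp 1 - 1" if dom: "x \<in> {1..} \<times> {1..}" for x
  proof -
    obtain m n where x: "x = (m, n)" "m \<ge> 1" "n \<ge> 1" using dom by (cases x) auto
    have "?f x \<le> (\<Sum>k=1..n. 1 / fact k)"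
      unfolding x(1) prod.case using x(2,3) by (rule Pplus_div_le)
    thus ?thesis using sum_inverse_fact_less[of n] by (rule order_trans[OF _ less_imp_le])
  qed
  show "(SUP x\<in>{1..} \<times> {1..}. ?f x) = exp 1 - 1"
  proof (rule antisym)
    show "(SUP x\<in>{1..} \<times> {1..}. ?f x) \<le> exp 1 - 1"
      by (rule cSUP_least[OF _ upper]) auto
    \<comment> \<open>Decks with one copy of each label suffice to approach the supremum.\<close>
    have "(\<Sum>k=1..n. 1 / fact k) \<le> (SUP x\<in>{1..} \<times> {1..}. ?f x)" if "n \<ge> 1" for n
    proof -
      have "(\<Sum>k=1..n. 1 / fact k) = ?f (1, n)"
        using Pplus_eq[of 1 n "TYPE('s)"] that by simp
      also have "\<dots> \<le> (SUP x\<in>{1..} \<times> {1..}. ?f x)"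
        using that by (intro cSUP_upper bdd_aboveI2[OF upper]) auto
      finally show ?thesis .
    qed
    thus "exp 1 - 1 \<le> (SUP x\<in>{1..} \<times> {1..}. ?f x)"
      by (intro LIMSEQ_le_const2[OF sum_inverse_fact_tendsto] exI[of _ 1]) simp
  qed
qed

end
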